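(* For a topological space $X$, the assignment sending the $n$-element linear order to the set $X^n$ equipped with the filter of topoic subsets, and sending a non-decreasing map $k\mapsto i_k$ from $\{1<\dots<m\}$ to $\{1<\dots<n\}$ to the map $X^n\to X^m$, $(x_1,\dots,x_n)\mapsto(x_{i_1},\dots,x_{i_m})$, is a well-defined functor $T(X):\mathrm{Ord}_{<\omega}^{op}\to \mathrm{Filt}$. Moreover, sending a continuous map $f:X\to X'$ to the natural transformation $T(X)\Rightarrow T(X')$ with components $f^n:X^n\to X'^n$ defines a fully faithful functor $$T:\mathrm{Top}\to \mathrm{Func}(\mathrm{Ord}_{<\omega}^{op},\mathrm{Filt})$$ from the category of topological spaces and continuous maps; in particular, continuous maps $X\to X'$ are in one-to-one correspondence with natural transformations $T(X)\Rightarrow T(X')$.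
   Context: $\mathrm{Filt}$ is the category of filters: an object is a set $S$ together with a collection of subsets of $S$, called big, containing $S$, closed under finite intersections and under passing to supersets (the empty set is allowed to be big). A morphism is a map of sets such that the preimage of every big subset is big. $\mathrm{Ord}_{<\omega}$ is the category of finite linear orders $\{1<\dots<n\}$, $0\le n<\omega$, and non-decreasing maps. Topoic subsets: let $X$ be a topological space and $n\ge 1$. A subset $P\subseteq X^n$ is topoic if: for each $x_1\in X$ there is an open neighbourhood $U_{x_1}\ni x_1$ such that for each $x_2\in U_{x_1}$ there is an open neighbourhood $U_{x_1,x_2}\ni x_2$ such that for each $x_3\in U_{x_1,x_2}$ there is an open neighbourhood $U_{x_1,x_2,x_3}\ni x_3$ such that $\dots$ for each $x_n\in U_{x_1,\dots,x_{n-1}}$ one has $(x_1,\dots,x_n)\in P$. In particular, for $n=1$ only $P=X$ is topoic, and for $n=2$, $P$ is topoic if and only if each $a\in X$ has a neighbourhood $U_a$ with $\{a\}\times U_a\subseteq P$. For $n=0$, the only topoic subset of the one-point set $X^0$ is $X^0$ itself. The big subsets of $X^n$ in $T(X)$ are the topoic subsets. *)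

theory Defs
  imports "HOL-Analysis.Abstract_Topology" "HOL-Library.FuncSet"
begin

(* Hom-sets of different pairs of objects need not be disjoint, so composition
   takes the three objects as arguments: Comp C a b c g f is g after f for
   f in Hom C a b and g in Hom C b c. *)
record ('o, 'm) cat =
  Ob :: "'o set"
  Hom :: "'o \<Rightarrow> 'o \<Rightarrow> 'm set"
  Ident :: "'o \<Rightarrow> 'm"
  Comp :: "'o \<Rightarrow> 'o \<Rightarrow> 'o \<Rightarrow> 'm \<Rightarrow> 'm \<Rightarrow> 'm"

definition is_category :: "('o, 'm) cat \<Rightarrow> bool" where
  "is_category C \<longleftrightarrow>
     (\<forall>a\<in>Ob C. Ident C a \<in> Hom C a a) \<and>
     (\<forall>a\<in>Ob C. \<forall>b\<in>Ob C. \<forall>c\<in>Ob C. \<forall>f\<in>Hom C a b. \<forall>g\<in>Hom C b c.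
        Comp C a b c g f \<in> Hom C a c) \<and>
     (\<forall>a\<in>Ob C. \<forall>b\<in>Ob C. \<forall>f\<in>Hom C a b.
        Comp C a a b f (Ident C a) = f \<and> Comp C a b b (Ident C b) f = f) \<and>
     (\<forall>a\<in>Ob C. \<forall>b\<in>Ob C. \<forall>c\<in>Ob C. \<forall>d\<in>Ob C.
        \<forall>f\<in>Hom C a b. \<forall>g\<in>Hom C b c. \<forall>h\<in>Hom C c d.
          Comp C a b d (Comp C b c d h g) f = Comp C a c d h (Comp C a b c g f))"

definition op_cat :: "('o, 'm) cat \<Rightarrow> ('o, 'm) cat" where
  "op_cat C = \<lparr>Ob = Ob C, Hom = (\<lambda>a b. Hom C b a), Ident = Ident C,
               Comp = (\<lambda>a b c g f. Comp C c b a f g)\<rparr>"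

record ('o, 'm, 'p, 'n) func =
  on_ob :: "'o \<Rightarrow> 'p"
  on_hom :: "'o \<Rightarrow> 'o \<Rightarrow> 'm \<Rightarrow> 'n"

(* Both maps are normalised to be undefined outside their domains, so that
   functors which agree on C are equal. *)
definition is_functor ::
    "('o, 'm) cat \<Rightarrow> ('p, 'n) cat \<Rightarrow> ('o, 'm, 'p, 'n) func \<Rightarrow> bool" where
  "is_functor C D F \<longleftrightarrow>
     is_category C \<and> is_category D \<and>
     on_ob F \<in> Ob C \<rightarrow>\<^sub>E Ob D \<and>
     (\<forall>a\<in>Ob C. \<forall>b\<in>Ob C.
        on_hom F a b \<in> Hom C a b \<rightarrow>\<^sub>E Hom D (on_ob F a) (on_ob F b)) \<and>
     (\<forall>a b. a \<notin> Ob C \<or> b \<notin> Ob C \<longrightarrow> on_hom F a b = (\<lambda>_. undefined)) \<and>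
     (\<forall>a\<in>Ob C. on_hom F a a (Ident C a) = Ident D (on_ob F a)) \<and>
     (\<forall>a\<in>Ob C. \<forall>b\<in>Ob C. \<forall>c\<in>Ob C. \<forall>f\<in>Hom C a b. \<forall>g\<in>Hom C b c.
        on_hom F a c (Comp C a b c g f) =
          Comp D (on_ob F a) (on_ob F b) (on_ob F c) (on_hom F b c g) (on_hom F a b f))"

definition faithful ::
    "('o, 'm) cat \<Rightarrow> ('p, 'n) cat \<Rightarrow> ('o, 'm, 'p, 'n) func \<Rightarrow> bool" where
  "faithful C D F \<longleftrightarrow> (\<forall>a\<in>Ob C. \<forall>b\<in>Ob C. inj_on (on_hom F a b) (Hom C a b))"

definition full ::
    "('o, 'm) cat \<Rightarrow> ('p, 'n) cat \<Rightarrow> ('o, 'm, 'p, 'n) func \<Rightarrow> bool" where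
  "full C D F \<longleftrightarrow> (\<forall>a\<in>Ob C. \<forall>b\<in>Ob C.
     on_hom F a b ` Hom C a b = Hom D (on_ob F a) (on_ob F b))"

definition nat_trans ::
    "('o, 'm) cat \<Rightarrow> ('p, 'n) cat \<Rightarrow> ('o, 'm, 'p, 'n) func \<Rightarrow> ('o, 'm, 'p, 'n) func
       \<Rightarrow> ('o \<Rightarrow> 'n) set" where
  "nat_trans C D F G =
     {\<eta> \<in> (\<Pi>\<^sub>E a\<in>Ob C. Hom D (on_ob F a) (on_ob G a)).
        \<forall>a\<in>Ob C. \<forall>b\<in>Ob C. \<forall>f\<in>Hom C a b.
          Comp D (on_ob F a) (on_ob F b) (on_ob G b) (\<eta> b) (on_hom F a b f) =
          Comp D (on_ob F a) (on_ob G a) (on_ob G b) (on_hom G a b f) (\<eta> a)}"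

definition Func_cat ::
    "('o, 'm) cat \<Rightarrow> ('p, 'n) cat \<Rightarrow> (('o, 'm, 'p, 'n) func, 'o \<Rightarrow> 'n) cat" where
  "Func_cat C D =
     \<lparr>Ob = {F. is_functor C D F},
      Hom = nat_trans C D,
      Ident = (\<lambda>F. \<lambda>a\<in>Ob C. Ident D (on_ob F a)),
      Comp = (\<lambda>F G H \<theta> \<eta>. \<lambda>a\<in>Ob C. Comp D (on_ob F a) (on_ob G a) (on_ob H a) (\<theta> a) (\<eta> a))\<rparr>"

definition Ord_cat :: "(nat, nat \<Rightarrow> nat) cat" where
  "Ord_cat =
     \<lparr>Ob = UNIV,
      Hom = (\<lambda>m n. {i \<in> {1..m} \<rightarrow>\<^sub>E {1..n}. mono_on {1..m} i}),
      Ident = (\<lambda>n. \<lambda>k\<in>{1..n}. k),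
      Comp = (\<lambda>l m n j i. compose {1..l} j i)\<rparr>"

(* A pair (S, B): the underlying set and the collection of its big subsets. *)
type_synonym 's filt = "'s set \<times> 's set set"

definition is_filt :: "'s filt \<Rightarrow> bool" where
  "is_filt A \<longleftrightarrow>
     snd A \<subseteq> Pow (fst A) \<and>
     fst A \<in> snd A \<and>
     (\<forall>P\<in>snd A. \<forall>Q\<in>snd A. P \<inter> Q \<in> snd A) \<and>
     (\<forall>P\<in>snd A. \<forall>Q. P \<subseteq> Q \<and> Q \<subseteq> fst A \<longrightarrow> Q \<in> snd A)"

definition Filt_cat :: "('s filt, 's \<Rightarrow> 's) cat" where
  "Filt_cat =
     \<lparr>Ob = {A. is_filt A},
      Hom = (\<lambda>A B. {f \<in> fst A \<rightarrow>\<^sub>E fst B. \<forall>P\<in>snd B. {x\<in>fst A. f x \<in> P} \<in> snd A}),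
      Ident = (\<lambda>A. \<lambda>x\<in>fst A. x),
      Comp = (\<lambda>A B C g f. compose (fst A) g f)\<rparr>"

(* The arbitrary type plays the role of the universe: all spaces carried by some subset of 'a. *)
definition Top_cat :: "('a topology, 'a \<Rightarrow> 'a) cat" where
  "Top_cat =
     \<lparr>Ob = UNIV,
      Hom = (\<lambda>X Y. {f \<in> extensional (topspace X). continuous_map X Y f}),
      Ident = (\<lambda>X. \<lambda>x\<in>topspace X. x),
      Comp = (\<lambda>X Y Z g f. compose (topspace X) g f)\<rparr>"

definition power_set :: "'a topology \<Rightarrow> nat \<Rightarrow> 'a list set" where
  "power_set X n = {xs. set xs \<subseteq> topspace X \<and> length xs = n}"

(* topoic_step X P k V [x1, ..., xj]: the part of the topoic condition that
   quantifies over the k remaining coordinates, the next of which ranges over V. *)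
fun topoic_step ::
    "'a topology \<Rightarrow> 'a list set \<Rightarrow> nat \<Rightarrow> 'a set \<Rightarrow> 'a list \<Rightarrow> bool" where
  "topoic_step X P 0 V xs \<longleftrightarrow> xs \<in> P"
| "topoic_step X P (Suc 0) V xs \<longleftrightarrow> (\<forall>x\<in>V. xs @ [x] \<in> P)"
| "topoic_step X P (Suc (Suc k)) V xs \<longleftrightarrow>
     (\<forall>x\<in>V. \<exists>U. openin X U \<and> x \<in> U \<and> topoic_step X P (Suc k) U (xs @ [x]))"

definition topoic :: "'a topology \<Rightarrow> nat \<Rightarrow> 'a list set \<Rightarrow> bool" where
  "topoic X n P \<longleftrightarrow> P \<subseteq> power_set X n \<and> topoic_step X P n (topspace X) []"

(* A morphism n \<rightarrow> m of the opposite of Ord_cat is a non-decreasing map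
   i : {1..m} \<rightarrow> {1..n}.  List positions count from 0, hence the shift. *)
definition T_ob ::
    "'a topology \<Rightarrow> (nat, nat \<Rightarrow> nat, 'a list filt, 'a list \<Rightarrow> 'a list) func" where
  "T_ob X =
     \<lparr>on_ob = (\<lambda>n. (power_set X n, {P. topoic X n P})),
      on_hom = (\<lambda>n m. \<lambda>i\<in>Hom (op_cat Ord_cat) n m. \<lambda>xs\<in>power_set X n.
                  map (\<lambda>k. xs ! (i k - 1)) [1..<Suc m])\<rparr>"

definition T_functor ::
    "('a topology, 'a \<Rightarrow> 'a,
      (nat, nat \<Rightarrow> nat, 'a list filt, 'a list \<Rightarrow> 'a list) func,
      nat \<Rightarrow> 'a list \<Rightarrow> 'a list) func" where
  "T_functor =
     \<lparr>on_ob = T_ob,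
      on_hom = (\<lambda>X Y. \<lambda>f\<in>Hom Top_cat X Y. \<lambda>n. \<lambda>xs\<in>power_set X n. map f xs)\<rparr>"

end

theory Submission
  imports Defs
begin

text \<open>
  A set of tuples is topoic if it is a winning condition for the player who answers each
  coordinate by an open neighbourhood confining the next one.  Three operations on such
  strategies make \<open>T\<close> a functor.

  \<^item> Two strategies can be followed at once by intersecting the neighbourhoods, so topoic
    sets form a filter (\<open>topoic_step_Int\<close>).

  \<^item> A strategy for \<open>(x\<^sub>i\<^sub>1, \<dots>, x\<^sub>i\<^sub>m)\<close> with non-decreasing indices gives one for
    \<open>(x\<^sub>1, \<dots>, x\<^sub>n)\<close> (\<open>topoic_step_reindex\<close>).  At an index that is skipped, the open set
    already in force is kept: being open, it is a neighbourhood of the skipped point too.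
    At an index that is used several times the same point is played repeatedly, which is
    legal because every answer contains the point it answers (\<open>topoic_step_repeat\<close>).

  \<^item> A strategy on \<open>Y\<close> pulls back along a continuous map \<open>X \<rightarrow> Y\<close> by taking preimages of the
    neighbourhoods (\<open>topoic_step_map\<close>).

  For full faithfulness, let \<open>\<eta>\<close> be a natural transformation \<open>T X \<Rightarrow> T Y\<close>, and let \<open>f\<close> be its
  component at the one-element order.  Naturality along the \<open>n\<close> inclusions of a point into
  \<open>{1 < \<dots> < n}\<close> says that the \<open>k\<close>-th coordinate of \<open>\<eta> n xs\<close> is \<open>f\<close> of the \<open>k\<close>-th coordinate of
  \<open>xs\<close>; hence \<open>\<eta> n\<close> is \<open>f\<close> applied coordinatewise, and \<open>f\<close> determines \<open>\<eta>\<close>.  Continuity of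
  \<open>f\<close> is read off from \<open>n = 2\<close>: for an open \<open>W\<close>, the set of pairs \<open>(a, b)\<close> such that
  \<open>a \<in> W\<close> implies \<open>b \<in> W\<close> is topoic, and its preimage being topoic means that each point of
  the preimage of \<open>W\<close> is interior to it (\<open>continuous_map_topoic\<close>).
\<close>

section \<open>Categories\<close>

lemma Comp_in_Hom:
  "is_category C \<Longrightarrow> a \<in> Ob C \<Longrightarrow> b \<in> Ob C \<Longrightarrow> c \<in> Ob C \<Longrightarrow>
    f \<in> Hom C a b \<Longrightarrow> g \<in> Hom C b c \<Longrightarrow> Comp C a b c g f \<in> Hom C a c"
  unfolding is_category_def by blast

text \<open>In a category of sets with structure and maps normalised outside their domain, the
  identity and associativity laws are those of restricted composition, so only closure
  under identities and composites depends on the structure.\<close>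

lemma is_category_concrete:
  assumes hom: "\<And>a b. Hom C a b \<subseteq> U a \<rightarrow>\<^sub>E U b"
    and ident: "\<And>a. Ident C a = (\<lambda>x\<in>U a. x)"
    and comp: "\<And>a b c g f. Comp C a b c g f = compose (U a) g f"
    and ident_closed: "\<And>a. a \<in> Ob C \<Longrightarrow> Ident C a \<in> Hom C a a"
    and comp_closed: "\<And>a b c f g. f \<in> Hom C a b \<Longrightarrow> g \<in> Hom C b c \<Longrightarrow>
          compose (U a) g f \<in> Hom C a c"
  shows "is_category C"
proof -
  have fs: "f \<in> U a \<rightarrow> U b" "f \<in> extensional (U a)" if "f \<in> Hom C a b" for f a b
    using hom[of a b] that by (auto simp: PiE_def)
  show ?thesis
    unfolding is_category_def
  proof (intro conjI ballI)
    fix a b f assume f: "f \<in> Hom C a b"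
    show "Comp C a a b f (Ident C a) = f"
      by (simp add: comp ident compose_Id[OF fs[OF f]])
    show "Comp C a b b (Ident C b) f = f"
      by (simp add: comp ident Id_compose[OF fs[OF f]])
  next
    fix a b c d f g h
    assume f: "f \<in> Hom C a b"
    show "Comp C a b d (Comp C b c d h g) f = Comp C a c d h (Comp C a b c g f)"
      by (simp add: comp compose_assoc[OF fs(1)[OF f]])
  qed (auto simp: comp ident_closed comp_closed)
qed

lemma is_category_op: "is_category C \<Longrightarrow> is_category (op_cat C)"
  unfolding is_category_def op_cat_def by simp

lemma is_category_Ord: "is_category Ord_cat"
proof (rule is_category_concrete[where U = "\<lambda>n. {1..n}"])
  fix a b c f g
  assume "f \<in> Hom Ord_cat a b" "g \<in> Hom Ord_cat b c"
  then have f: "f \<in> {1..a} \<rightarrow>\<^sub>E {1..b}" "mono_on {1..a} f"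
    and g: "g \<in> {1..b} \<rightarrow>\<^sub>E {1..c}" "mono_on {1..b} g"
    by (auto simp: Ord_cat_def)
  have "mono_on {1..a} (compose {1..a} g f)"
  proof (rule mono_onI)
    fix r s assume rs: "r \<in> {1..a}" "s \<in> {1..a}" "r \<le> s"
    have "f r \<in> {1..b}" "f s \<in> {1..b}"
      using f(1) rs(1,2) by blast+
    then have "g (f r) \<le> g (f s)"
      using mono_onD[OF g(2)] mono_onD[OF f(2) rs] by blast
    then show "compose {1..a} g f r \<le> compose {1..a} g f s"
      using rs by (simp add: compose_eq)
  qed
  then show "compose {1..a} g f \<in> Hom Ord_cat a c"
    using f(1) g(1) by (auto simp: Ord_cat_def compose_def)
qed (auto simp: Ord_cat_def mono_on_def)

lemma is_category_Filt: "is_category (Filt_cat :: ('s filt, 's \<Rightarrow> 's) cat)"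
proof (rule is_category_concrete[where U = fst])
  fix A :: "'s filt" assume "A \<in> Ob Filt_cat"
  then have "snd A \<subseteq> Pow (fst A)"
    by (simp add: Filt_cat_def is_filt_def)
  then have "{x \<in> fst A. (\<lambda>x\<in>fst A. x) x \<in> P} = P" if "P \<in> snd A" for P
    using that by auto
  then show "Ident Filt_cat A \<in> Hom Filt_cat A A"
    by (auto simp: Filt_cat_def)
next
  fix A B D :: "'s filt" and f g
  assume "f \<in> Hom Filt_cat A B" "g \<in> Hom Filt_cat B D"
  then have f: "f \<in> fst A \<rightarrow>\<^sub>E fst B" "\<And>P. P \<in> snd B \<Longrightarrow> {x\<in>fst A. f x \<in> P} \<in> snd A"
    and g: "g \<in> fst B \<rightarrow>\<^sub>E fst D" "\<And>P. P \<in> snd D \<Longrightarrow> {x\<in>fst B. g x \<in> P} \<in> snd B"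
    by (auto simp: Filt_cat_def)
  have "{x\<in>fst A. compose (fst A) g f x \<in> P} \<in> snd A" if "P \<in> snd D" for P
  proof -
    have "{x\<in>fst A. compose (fst A) g f x \<in> P} = {x\<in>fst A. f x \<in> {y\<in>fst B. g y \<in> P}}"
      using f(1) by (auto simp: compose_eq)
    then show ?thesis
      using f(2)[OF g(2)[OF that]] by simp
  qed
  moreover have "compose (fst A) g f \<in> fst A \<rightarrow>\<^sub>E fst D"
    using f(1) g(1) by (auto simp: compose_def)
  ultimately show "compose (fst A) g f \<in> Hom Filt_cat A D"
    by (simp add: Filt_cat_def)
qed (auto simp: Filt_cat_def)

lemma is_category_Top: "is_category (Top_cat :: ('a topology, 'a \<Rightarrow> 'a) cat)"
proof (rule is_category_concrete[where U = topspace])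
  show "Hom Top_cat X Y \<subseteq> topspace X \<rightarrow>\<^sub>E topspace Y" for X Y :: "'a topology"
    by (auto simp: Top_cat_def PiE_def continuous_map_def)
  show "Ident Top_cat X \<in> Hom Top_cat X X" for X :: "'a topology"
  proof -
    have "continuous_map X X (\<lambda>x\<in>topspace X. x)"
      by (rule continuous_map_eq[OF continuous_map_id]) simp
    then show ?thesis
      by (simp add: Top_cat_def)
  qed
  show "compose (topspace X) g f \<in> Hom Top_cat X Z"
    if "f \<in> Hom Top_cat X Y" "g \<in> Hom Top_cat Y Z" for X Y Z :: "'a topology" and f g
  proof -
    have "continuous_map X Z (g \<circ> f)"
      using that continuous_map_compose by (auto simp: Top_cat_def)
    then have "continuous_map X Z (compose (topspace X) g f)"
      by (rule continuous_map_eq) (simp add: compose_eq)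
    then show ?thesis
      by (simp add: Top_cat_def)
  qed
qed (auto simp: Top_cat_def)

lemma is_category_Func:
  assumes C: "is_category C" and D: "is_category D"
  shows "is_category (Func_cat C D)"
proof -
  have ob: "on_ob F a \<in> Ob D" if "is_functor C D F" "a \<in> Ob C" for F a
    using that by (auto simp: is_functor_def)
  have hom: "on_hom F a b f \<in> Hom D (on_ob F a) (on_ob F b)"
    if "is_functor C D F" "a \<in> Ob C" "b \<in> Ob C" "f \<in> Hom C a b" for F a b f
    using that by (auto simp: is_functor_def)
  have ident: "Ident D x \<in> Hom D x x" if "x \<in> Ob D" for x
    using D that unfolding is_category_def by blast
  have unit: "Comp D x x y f (Ident D x) = f" "Comp D x y y (Ident D y) f = f"
    if "x \<in> Ob D" "y \<in> Ob D" "f \<in> Hom D x y" for x y f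
    using D that unfolding is_category_def by blast+
  have assoc: "Comp D w x z (Comp D x y z h g) f = Comp D w y z h (Comp D w x y g f)"
    if "w \<in> Ob D" "x \<in> Ob D" "y \<in> Ob D" "z \<in> Ob D"
      "f \<in> Hom D w x" "g \<in> Hom D x y" "h \<in> Hom D y z" for w x y z f g h
    using D that unfolding is_category_def by blast
  have nt: "\<eta> a \<in> Hom D (on_ob F a) (on_ob G a)"
    if "\<eta> \<in> nat_trans C D F G" "a \<in> Ob C" for \<eta> F G a
    using that by (auto simp: nat_trans_def)
  have nt_ext: "\<eta> a = undefined" if "\<eta> \<in> nat_trans C D F G" "a \<notin> Ob C" for \<eta> F G a
    using that by (auto simp: nat_trans_def PiE_def extensional_def)
  have nat: "Comp D (on_ob F a) (on_ob F b) (on_ob G b) (\<eta> b) (on_hom F a b f) =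
      Comp D (on_ob F a) (on_ob G a) (on_ob G b) (on_hom G a b f) (\<eta> a)"
    if "\<eta> \<in> nat_trans C D F G" "a \<in> Ob C" "b \<in> Ob C" "f \<in> Hom C a b" for \<eta> F G a b f
    using that by (auto simp: nat_trans_def)
  let ?id = "\<lambda>F. \<lambda>a\<in>Ob C. Ident D (on_ob F a)"
  let ?comp = "\<lambda>F G H \<theta> \<eta>. \<lambda>a\<in>Ob C. Comp D (on_ob F a) (on_ob G a) (on_ob H a) (\<theta> a) (\<eta> a)"
  have id_closed: "?id F \<in> nat_trans C D F F" if F: "is_functor C D F" for F
    unfolding nat_trans_def using F
    by (auto simp: unit ob hom ident)
  have comp_closed: "?comp F G H \<theta> \<eta> \<in> nat_trans C D F H"
    if F: "is_functor C D F" and G: "is_functor C D G" and H: "is_functor C D H"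
      and \<eta>: "\<eta> \<in> nat_trans C D F G" and \<theta>: "\<theta> \<in> nat_trans C D G H" for F G H \<theta> \<eta>
  proof -
    have "?comp F G H \<theta> \<eta> \<in> (\<Pi>\<^sub>E a\<in>Ob C. Hom D (on_ob F a) (on_ob H a))"
      using Comp_in_Hom[OF D] ob[OF F] ob[OF G] ob[OF H] nt[OF \<eta>] nt[OF \<theta>] by auto
    moreover have
      "Comp D (on_ob F a) (on_ob F b) (on_ob H b) (?comp F G H \<theta> \<eta> b) (on_hom F a b f) =
       Comp D (on_ob F a) (on_ob H a) (on_ob H b) (on_hom H a b f) (?comp F G H \<theta> \<eta> a)"
      if ab: "a \<in> Ob C" "b \<in> Ob C" and f: "f \<in> Hom C a b" for a b f
    proof -
      note obs = ob[OF F ab(1)] ob[OF F ab(2)] ob[OF G ab(1)] ob[OF G ab(2)]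
        ob[OF H ab(1)] ob[OF H ab(2)]
      note homs = hom[OF F ab f] hom[OF G ab f] hom[OF H ab f] nt[OF \<eta> ab(1)] nt[OF \<eta> ab(2)]
        nt[OF \<theta> ab(1)] nt[OF \<theta> ab(2)]
      let ?Fa = "on_ob F a" and ?Fb = "on_ob F b" and ?Ga = "on_ob G a" and ?Gb = "on_ob G b"
        and ?Ha = "on_ob H a" and ?Hb = "on_ob H b"
      have "Comp D ?Fa ?Fb ?Hb (Comp D ?Fb ?Gb ?Hb (\<theta> b) (\<eta> b)) (on_hom F a b f)
          = Comp D ?Fa ?Gb ?Hb (\<theta> b) (Comp D ?Fa ?Fb ?Gb (\<eta> b) (on_hom F a b f))"
        by (simp add: assoc obs homs)
      also have "\<dots> = Comp D ?Fa ?Gb ?Hb (\<theta> b) (Comp D ?Fa ?Ga ?Gb (on_hom G a b f) (\<eta> a))"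
        by (simp add: nat[OF \<eta> ab f])
      also have "\<dots> = Comp D ?Fa ?Ga ?Hb (Comp D ?Ga ?Gb ?Hb (\<theta> b) (on_hom G a b f)) (\<eta> a)"
        by (simp add: assoc obs homs)
      also have "\<dots> = Comp D ?Fa ?Ga ?Hb (Comp D ?Ga ?Ha ?Hb (on_hom H a b f) (\<theta> a)) (\<eta> a)"
        by (simp add: nat[OF \<theta> ab f])
      also have "\<dots> = Comp D ?Fa ?Ha ?Hb (on_hom H a b f) (Comp D ?Fa ?Ga ?Ha (\<theta> a) (\<eta> a))"
        by (simp add: assoc obs homs)
      finally show ?thesis
        using ab by simp
    qed
    ultimately show ?thesis
      by (simp add: nat_trans_def)
  qed
  show ?thesis
    unfolding is_category_def Func_cat_def
    apply (simp only: cat.simps mem_Collect_eq)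
    apply (intro conjI ballI)
    subgoal by (simp add: id_closed)
    subgoal by (simp add: comp_closed)
    subgoal for F G \<eta> by (rule ext) (auto simp: unit ob nt nt_ext)
    subgoal for F G \<eta> by (rule ext) (auto simp: unit ob nt nt_ext)
    subgoal for F G H K \<eta> \<theta> \<zeta>
      by (rule ext) (auto simp: assoc[OF ob ob ob ob nt nt nt])
    done
qed

section \<open>Topoic subsets\<close>

text \<open>The two successor clauses of the recursion merge: a last coordinate carries no
  neighbourhood condition, but demanding one is harmless, since the whole space serves.\<close>

lemma topoic_step_Suc:
  assumes "V \<subseteq> topspace X"
  shows "topoic_step X P (Suc k) V xs \<longleftrightarrow>
    (\<forall>x\<in>V. \<exists>U. openin X U \<and> x \<in> U \<and> topoic_step X P k U (xs @ [x]))"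
  using assms by (cases k) auto

lemmas topoic_step_Suc_open = topoic_step_Suc[OF openin_subset]

lemma topoic_step_Int:
  assumes "topoic_step X P k V xs" "topoic_step X Q k W xs" "openin X V" "openin X W"
  shows "topoic_step X (P \<inter> Q) k (V \<inter> W) xs"
  using assms
proof (induction k arbitrary: V W xs)
  case (Suc k)
  have "\<exists>U. openin X U \<and> x \<in> U \<and> topoic_step X (P \<inter> Q) k U (xs @ [x])" if x: "x \<in> V \<inter> W" for x
  proof -
    obtain U where U: "openin X U" "x \<in> U" "topoic_step X P k U (xs @ [x])"
      using Suc.prems(1) x by (auto simp: topoic_step_Suc_open[OF Suc.prems(3)])
    obtain U' where U': "openin X U'" "x \<in> U'" "topoic_step X Q k U' (xs @ [x])"
      using Suc.prems(2) x by (auto simp: topoic_step_Suc_open[OF Suc.prems(4)])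
    show ?thesis
      using Suc.IH[OF U(3) U'(3) U(1) U'(1)] U U' by blast
  qed
  then show ?case
    using Suc.prems by (simp add: topoic_step_Suc_open openin_Int)
qed simp

text \<open>The answer to \<open>x\<close> contains \<open>x\<close>, so \<open>x\<close> may be played again and again.\<close>

lemma topoic_step_repeat:
  assumes "topoic_step X P (r + k) V ys" "openin X V" "x \<in> V"
  shows "\<exists>U. openin X U \<and> x \<in> U \<and> topoic_step X P k U (ys @ replicate r x)"
  using assms
proof (induction r arbitrary: V ys)
  case (Suc r)
  then obtain U where "openin X U" "x \<in> U" "topoic_step X P (r + k) U (ys @ [x])"
    by (auto simp: topoic_step_Suc_open)
  from Suc.IH[OF this(3,1,2)] show ?case
    by simp
qed auto

text \<open>Reindexing is proved by induction on the number of coordinates: of a sorted list of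
  positions in \<open>x # zs\<close>, the leading zeros refer to \<open>x\<close> and the rest are positions in \<open>zs\<close>,
  shifted by one.\<close>

lemma sorted_eq_replicate_0_Suc:
  fixes js :: "nat list"
  assumes "sorted js"
  obtains r ks where "js = replicate r 0 @ map Suc ks" "sorted ks"
proof -
  have "\<exists>r ks. js = replicate r 0 @ map Suc ks \<and> sorted ks"
    using assms
  proof (induction js)
    case (Cons j js)
    then obtain r ks where IH: "js = replicate r 0 @ map Suc ks" "sorted ks"
      by auto
    show ?case
    proof (cases j)
      case 0
      then show ?thesis
        using IH by (intro exI[of _ "Suc r"] exI[of _ ks]) simp
    next
      case (Suc j')
      with Cons.prems IH have "r = 0"
        by (cases r) auto
      with Cons.prems IH Suc show ?thesis
        by (intro exI[of _ 0] exI[of _ "j' # ks"]) auto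
    qed
  qed simp
  then show thesis
    using that by blast
qed

text \<open>Here \<open>ys\<close> collects the coordinates already selected from \<open>xs\<close>, and \<open>js\<close> lists the
  positions still to be selected, counted in the unplayed part \<open>zs\<close>.  The induction turns a
  strategy for \<open>P\<close> after \<open>ys\<close> into one for \<open>Q\<close> after \<open>xs\<close>: a new coordinate \<open>x\<close> is passed on as
  often as \<open>js\<close> begins with position 0, and if it does not, the current open set \<open>V\<close> is
  itself the answer.  Passing to supersets is the
  instance where every position is selected, and the topoicity of the whole power the
  instance where none is.\<close>

lemma topoic_step_reindex:
  assumes "topoic_step X P (length js) V ys" "openin X V" "sorted js" "set js \<subseteq> {..<n}"
    and "\<And>zs. zs \<in> power_set X n \<Longrightarrow> ys @ map ((!) zs) js \<in> P \<Longrightarrow> xs @ zs \<in> Q"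
  shows "topoic_step X Q n V xs"
  using assms
proof (induction n arbitrary: js V xs ys)
  case 0
  then show ?case
    using "0.prems"(5)[of "[]"] by (simp add: power_set_def)
next
  case (Suc n)
  obtain r ks where js: "js = replicate r 0 @ map Suc ks" and ks: "sorted ks"
    using sorted_eq_replicate_0_Suc[OF Suc.prems(3)] .
  have "\<exists>U. openin X U \<and> x \<in> U \<and> topoic_step X Q n U (xs @ [x])" if x: "x \<in> V" for x
  proof -
    obtain U where U: "openin X U" "x \<in> U"
      "topoic_step X P (length ks) U (ys @ replicate r x)"
      using topoic_step_repeat[of X P r "length ks" V ys x] Suc.prems(1,2) js x by auto
    have "topoic_step X Q n U (xs @ [x])"
    proof (rule Suc.IH[OF U(3,1) ks])
      show "set ks \<subseteq> {..<n}"
        using Suc.prems(4) js by auto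
      fix zs assume zs: "zs \<in> power_set X n"
        and P: "(ys @ replicate r x) @ map ((!) zs) ks \<in> P"
      have "x # zs \<in> power_set X (Suc n)"
        using zs x openin_subset[OF Suc.prems(2)] by (auto simp: power_set_def)
      moreover have "map ((!) (x # zs)) js = replicate r x @ map ((!) zs) ks"
        by (simp add: js)
      ultimately show "(xs @ [x]) @ zs \<in> Q"
        using Suc.prems(5)[of "x # zs"] P by simp
    qed
    with U show ?thesis
      by blast
  qed
  then show ?case
    using Suc.prems(2) by (simp add: topoic_step_Suc_open)
qed

lemma topoic_reindex:
  assumes "topoic X (length js) P" "sorted js" "set js \<subseteq> {..<n}"
  shows "topoic X n {xs \<in> power_set X n. map ((!) xs) js \<in> P}"
  using assms topoic_step_reindex[of X P js "topspace X" "[]" n "[]"]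
  by (auto simp: topoic_def)

lemma topoic_superset:
  assumes "topoic X n P" "P \<subseteq> Q" "Q \<subseteq> power_set X n"
  shows "topoic X n Q"
proof -
  have idx: "map ((!) xs) [0..<n] = xs" if "xs \<in> power_set X n" for xs
    using that map_nth[of xs] by (simp add: power_set_def)
  have "topoic_step X Q n (topspace X) []"
    using assms topoic_step_reindex[of X P "[0..<n]" "topspace X" "[]" n "[]" Q]
    by (auto simp: topoic_def idx lessThan_atLeast0)
  then show ?thesis
    using assms by (simp add: topoic_def)
qed

lemma topoic_Int: "topoic X n P \<Longrightarrow> topoic X n Q \<Longrightarrow> topoic X n (P \<inter> Q)"
  using topoic_step_Int[of X P n "topspace X" "[]" Q "topspace X"]
  by (auto simp: topoic_def)

lemma topoic_power_set: "topoic X n (power_set X n)"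
  using topoic_step_reindex[of X "{[]}" "[]" "topspace X" "[]" n "[]" "power_set X n"]
  by (simp add: topoic_def)

text \<open>A point is answered by the preimage of the answer to its image, which is open by
  continuity.\<close>

lemma topoic_step_map:
  assumes f: "continuous_map X Y f"
    and "topoic_step Y P n W (map f xs)" "openin Y W"
    and "\<And>zs. zs \<in> power_set X n \<Longrightarrow> map f (xs @ zs) \<in> P \<Longrightarrow> xs @ zs \<in> Q"
  shows "topoic_step X Q n {x \<in> topspace X. f x \<in> W} xs"
  using assms(2-)
proof (induction n arbitrary: W xs)
  case 0
  then show ?case
    using "0.prems"(3)[of "[]"] by (simp add: power_set_def)
next
  case (Suc n)
  let ?pre = "\<lambda>U. {x \<in> topspace X. f x \<in> U}"
  have "\<exists>U. openin X U \<and> x \<in> U \<and> topoic_step X Q n U (xs @ [x])" if x: "x \<in> ?pre W" for x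
  proof -
    obtain U where U: "openin Y U" "f x \<in> U" "topoic_step Y P n U (map f (xs @ [x]))"
      using Suc.prems(1) x by (auto simp: topoic_step_Suc_open[OF Suc.prems(2)])
    have "topoic_step X Q n (?pre U) (xs @ [x])"
    proof (rule Suc.IH[OF U(3,1)])
      fix zs assume "zs \<in> power_set X n" "map f ((xs @ [x]) @ zs) \<in> P"
      then show "(xs @ [x]) @ zs \<in> Q"
        using Suc.prems(3)[of "x # zs"] x by (auto simp: power_set_def)
    qed
    moreover have "openin X (?pre U)"
      using f U(1) by (rule openin_continuous_map_preimage)
    ultimately show ?thesis
      using U x by blast
  qed
  then show ?case
    by (simp add: topoic_step_Suc[of "?pre W"])
qed

lemma topoic_map:
  assumes f: "continuous_map X Y f" and P: "topoic Y n P"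
  shows "topoic X n {xs \<in> power_set X n. map f xs \<in> P}"
proof -
  have "{x \<in> topspace X. f x \<in> topspace Y} = topspace X"
    using continuous_map_image_subset_topspace[OF f] by auto
  then show ?thesis
    using topoic_step_map[OF f, of P n "topspace Y" "[]"] P by (simp add: topoic_def)
qed

lemma topoic_2:
  "topoic X 2 P \<longleftrightarrow> P \<subseteq> power_set X 2 \<and>
    (\<forall>x\<in>topspace X. \<exists>U. openin X U \<and> x \<in> U \<and> (\<forall>y\<in>U. [x, y] \<in> P))"
  by (simp add: topoic_def numeral_2_eq_2)

text \<open>Continuity is already detected by pairs: the topoic sets of pairs encode the
  neighbourhoods of every point.\<close>

lemma continuous_map_topoic:
  assumes im: "f \<in> topspace X \<rightarrow> topspace Y"
    and big: "\<And>P. topoic Y 2 P \<Longrightarrow> topoic X 2 {xs \<in> power_set X 2. map f xs \<in> P}"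
  shows "continuous_map X Y f"
  unfolding continuous_map_def
proof (intro conjI allI impI im)
  fix W assume W: "openin Y W"
  (* The strategy for this set answers a point of W by W and any other point by the whole space. *)
  let ?P = "{ys \<in> power_set Y 2. ys ! 0 \<in> W \<longrightarrow> ys ! 1 \<in> W}"
  have "\<exists>U. openin Y U \<and> y \<in> U \<and> (\<forall>z\<in>U. [y, z] \<in> ?P)" if y: "y \<in> topspace Y" for y
  proof (cases "y \<in> W")
    case True
    with W y openin_subset[OF W] show ?thesis
      by (intro exI[of _ W]) (auto simp: power_set_def)
  next
    case False
    with y show ?thesis
      by (intro exI[of _ "topspace Y"]) (auto simp: power_set_def)
  qed
  then have "topoic Y 2 ?P"
    by (auto simp: topoic_2)
  from big[OF this] have step:
    "\<exists>U. openin X U \<and> x \<in> U \<and> (\<forall>y\<in>U. f x \<in> W \<longrightarrow> f y \<in> W)" if "x \<in> topspace X" for x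
    using that by (fastforce simp: topoic_2)
  show "openin X {x \<in> topspace X. f x \<in> W}"
  proof (subst openin_subopen, intro ballI)
    fix x assume x: "x \<in> {x \<in> topspace X. f x \<in> W}"
    then obtain U where U: "openin X U" "x \<in> U" "\<forall>y\<in>U. f y \<in> W"
      using step[of x] by auto
    then show "\<exists>T. openin X T \<and> x \<in> T \<and> T \<subseteq> {x \<in> topspace X. f x \<in> W}"
      using openin_subset by (intro exI[of _ U]) blast
  qed
qed

section \<open>The functor of a space\<close>

lemma is_filt_topoic: "is_filt (power_set X n, {P. topoic X n P})"
  unfolding is_filt_def
  by (auto simp: topoic_power_set topoic_Int intro: topoic_superset) (auto simp: topoic_def)

lemma Hom_op_Ord: "Hom (op_cat Ord_cat) n m = {i \<in> {1..m} \<rightarrow>\<^sub>E {1..n}. mono_on {1..m} i}"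
  by (simp add: op_cat_def Ord_cat_def)

text \<open>Elements of the linear orders count from 1 and list positions from 0.\<close>

definition reindex :: "nat \<Rightarrow> (nat \<Rightarrow> nat) \<Rightarrow> 'a list \<Rightarrow> 'a list" where
  "reindex m i xs = map (\<lambda>k. xs ! (i k - 1)) [1..<Suc m]"

lemma nth_reindex: "k \<in> {1..m} \<Longrightarrow> reindex m i xs ! (k - 1) = xs ! (i k - 1)"
  unfolding reindex_def by (subst nth_map) (auto simp del: upt_Suc simp: nth_upt)

lemma reindex_in_power_set:
  assumes "i \<in> {1..m} \<rightarrow> {1..n}" "xs \<in> power_set X n"
  shows "reindex m i xs \<in> power_set X m"
proof -
  have "xs ! (i k - 1) \<in> topspace X" if "k \<in> {1..m}" for k
  proof -
    have "i k \<in> {1..n}"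
      using assms(1) that by blast
    then have "i k - 1 < length xs"
      using assms(2) by (auto simp: power_set_def)
    then show ?thesis
      using assms(2) nth_mem by (auto simp: power_set_def)
  qed
  then show ?thesis
    by (auto simp: power_set_def reindex_def simp del: upt_Suc)
qed

lemma topoic_reindex_Ord:
  assumes i: "i \<in> Hom (op_cat Ord_cat) n m" and P: "topoic X m P"
  shows "topoic X n {xs \<in> power_set X n. reindex m i xs \<in> P}"
proof -
  let ?js = "map (\<lambda>k. i k - 1) [1..<Suc m]"
  have mono: "mono_on {1..m} i" and into: "i \<in> {1..m} \<rightarrow> {1..n}"
    using i by (auto simp: Hom_op_Ord)
  have "sorted ?js"
    unfolding sorted_map
    by (rule sorted_wrt_mono_rel[OF _ sorted_upt])
      (auto intro!: diff_le_mono mono_onD[OF mono])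
  moreover have "set ?js \<subseteq> {..<n}"
  proof
    fix j assume "j \<in> set ?js"
    then obtain k where "k \<in> set [1..<Suc m]" "j = i k - 1"
      unfolding set_map by (rule imageE)
    then have "k \<in> {1..m}" "j = i k - 1"
      by auto
    moreover from this into have "i k \<in> {1..n}"
      by blast
    ultimately show "j \<in> {..<n}"
      by auto
  qed
  moreover have "map ((!) xs) ?js = reindex m i xs" for xs :: "'a list"
    by (simp add: comp_def reindex_def del: upt_Suc)
  ultimately show ?thesis
    using topoic_reindex[of X ?js P n] P by (simp del: upt_Suc)
qed

lemma on_ob_T_ob: "on_ob (T_ob X) n = (power_set X n, {P. topoic X n P})"
  by (simp add: T_ob_def)

lemma on_hom_T_ob:
  "i \<in> Hom (op_cat Ord_cat) n m \<Longrightarrow>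
    on_hom (T_ob X) n m i = (\<lambda>xs\<in>power_set X n. reindex m i xs)"
  by (simp add: T_ob_def reindex_def del: upt_Suc)

lemma Hom_Filt_T_ob:
  "Hom Filt_cat (on_ob (T_ob X) n) (on_ob (T_ob Y) m) =
    {g \<in> power_set X n \<rightarrow>\<^sub>E power_set Y m.
      \<forall>P. topoic Y m P \<longrightarrow> topoic X n {xs \<in> power_set X n. g xs \<in> P}}"
  by (simp add: Filt_cat_def on_ob_T_ob)

lemma Comp_Filt_T_ob:
  "Comp Filt_cat (on_ob (T_ob X) n) B C g f = compose (power_set X n) g f"
  by (simp add: Filt_cat_def on_ob_T_ob)

lemma restrict_in_Hom_Filt_T_ob:
  assumes "\<And>xs. xs \<in> power_set X n \<Longrightarrow> g xs \<in> power_set Y m"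
    and "\<And>P. topoic Y m P \<Longrightarrow> topoic X n {xs \<in> power_set X n. g xs \<in> P}"
  shows "(\<lambda>xs\<in>power_set X n. g xs) \<in> Hom Filt_cat (on_ob (T_ob X) n) (on_ob (T_ob Y) m)"
proof -
  have "{xs \<in> power_set X n. (\<lambda>xs\<in>power_set X n. g xs) xs \<in> P} =
      {xs \<in> power_set X n. g xs \<in> P}" for P
    by auto
  then show ?thesis
    using assms by (simp add: Hom_Filt_T_ob)
qed

lemma is_functor_T_ob: "is_functor (op_cat Ord_cat) Filt_cat (T_ob X)"
proof -
  let ?C = "op_cat Ord_cat"
  have ob: "Ob ?C = UNIV" "Ident ?C n = (\<lambda>k\<in>{1..n}. k)"
    "Comp ?C l m n j i = compose {1..n} i j" for l m n i j
    by (simp_all add: op_cat_def Ord_cat_def)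
  have cat: "is_category ?C"
    by (intro is_category_op is_category_Ord)
  have ident: "on_hom (T_ob X) n n (Ident ?C n) = Ident Filt_cat (on_ob (T_ob X) n)" for n
  proof -
    have "Ident ?C n \<in> Hom ?C n n"
      using cat unfolding is_category_def by (simp add: ob(1))
    moreover have "reindex n (\<lambda>k\<in>{1..n}. k) xs = xs" if "xs \<in> power_set X n" for xs
      using that by (intro nth_equalityI) (auto simp: power_set_def reindex_def simp del: upt_Suc)
    ultimately show ?thesis
      by (auto simp: on_hom_T_ob ob(2) Filt_cat_def on_ob_T_ob intro!: restrict_ext)
  qed
  have comp: "on_hom (T_ob X) l n (Comp ?C l m n j i) =
      Comp Filt_cat (on_ob (T_ob X) l) (on_ob (T_ob X) m) (on_ob (T_ob X) n)
        (on_hom (T_ob X) m n j) (on_hom (T_ob X) l m i)"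
    if i: "i \<in> Hom ?C l m" and j: "j \<in> Hom ?C m n" for l m n i j
  proof -
    have c: "compose {1..n} i j \<in> Hom ?C l n"
      using Comp_in_Hom[OF cat _ _ _ i j] by (simp add: ob(1,3))
    have re: "reindex n (compose {1..n} i j) xs = reindex n j (reindex m i xs)" for xs :: "'a list"
      unfolding reindex_def[of n]
    proof (rule map_cong[OF refl])
      fix k assume "k \<in> set [1..<Suc n]"
      then have k: "k \<in> {1..n}"
        by auto
      then have "j k \<in> {1..m}"
        using j by (auto simp: Hom_op_Ord)
      then show "xs ! (compose {1..n} i j k - 1) = reindex m i xs ! (j k - 1)"
        using k by (simp only: nth_reindex compose_eq)
    qed
    have im: "reindex m i xs \<in> power_set X m" if "xs \<in> power_set X l" for xs
      using i that by (intro reindex_in_power_set) (auto simp: Hom_op_Ord)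
    show ?thesis
      unfolding ob(3) on_hom_T_ob[OF c] on_hom_T_ob[OF i] on_hom_T_ob[OF j] Comp_Filt_T_ob
      by (rule extensionalityI[where A = "power_set X l"]) (simp_all add: compose_eq re im del: One_nat_def)
  qed
  have hom: "on_hom (T_ob X) n m \<in> Hom ?C n m \<rightarrow>\<^sub>E Hom Filt_cat (on_ob (T_ob X) n) (on_ob (T_ob X) m)"
    for n m
  proof (rule PiE_I)
    fix i assume i: "i \<in> Hom ?C n m"
    then have "i \<in> {1..m} \<rightarrow> {1..n}"
      by (auto simp: Hom_op_Ord)
    then show "on_hom (T_ob X) n m i \<in> Hom Filt_cat (on_ob (T_ob X) n) (on_ob (T_ob X) m)"
      unfolding on_hom_T_ob[OF i]
      by (intro restrict_in_Hom_Filt_T_ob reindex_in_power_set topoic_reindex_Ord i)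
  qed (simp add: T_ob_def)
  have "on_ob (T_ob X) n \<in> Ob Filt_cat" for n
    by (simp add: on_ob_T_ob Filt_cat_def is_filt_topoic)
  then show ?thesis
    unfolding is_functor_def
    using cat hom ident comp by (simp add: ob(1) is_category_Filt PiE_UNIV_domain)
qed

section \<open>Functoriality in the space and full faithfulness\<close>

lemma map_in_power_set:
  "f \<in> topspace X \<rightarrow> topspace Y \<Longrightarrow> xs \<in> power_set X n \<Longrightarrow> map f xs \<in> power_set Y n"
  by (auto simp: power_set_def)

lemma nat_trans_T_obI:
  assumes f: "continuous_map X Y f"
  shows "(\<lambda>n. \<lambda>xs\<in>power_set X n. map f xs) \<in>
    nat_trans (op_cat Ord_cat) Filt_cat (T_ob X) (T_ob Y)"
proof -
  have im: "f \<in> topspace X \<rightarrow> topspace Y"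
    using f by (simp add: continuous_map_def)
  have hom: "(\<lambda>xs\<in>power_set X n. map f xs) \<in>
      Hom Filt_cat (on_ob (T_ob X) n) (on_ob (T_ob Y) n)" for n
    by (intro restrict_in_Hom_Filt_T_ob map_in_power_set[OF im] topoic_map[OF f])
  have natural: "compose (power_set X n) (\<lambda>xs\<in>power_set X m. map f xs) (on_hom (T_ob X) n m i) =
      compose (power_set X n) (on_hom (T_ob Y) n m i) (\<lambda>xs\<in>power_set X n. map f xs)"
    if i: "i \<in> Hom (op_cat Ord_cat) n m" for n m i
  proof -
    have into: "i \<in> {1..m} \<rightarrow> {1..n}"
      using i by (auto simp: Hom_op_Ord)
    have "map f (reindex m i xs) = reindex m i (map f xs)" if xs: "xs \<in> power_set X n" for xs
    proof -
      have "i k - 1 < length xs" if "k \<in> {1..m}" for k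
        using into that xs by (force simp: power_set_def)
      then show ?thesis
        by (auto simp: reindex_def simp del: upt_Suc)
    qed
    then show ?thesis
      by (auto simp: on_hom_T_ob[OF i] compose_def reindex_in_power_set[OF into]
          map_in_power_set[OF im] intro!: restrict_ext)
  qed
  show ?thesis
    using hom natural
    by (auto simp: nat_trans_def Comp_Filt_T_ob op_cat_def Ord_cat_def)
qed

lemma on_hom_T_functor:
  "f \<in> Hom Top_cat X Y \<Longrightarrow>
    on_hom T_functor X Y f = (\<lambda>n. \<lambda>xs\<in>power_set X n. map f xs)"
  by (simp add: T_functor_def)

lemma is_functor_T_functor:
  "is_functor (Top_cat :: ('a topology, 'a \<Rightarrow> 'a) cat)
     (Func_cat (op_cat Ord_cat) Filt_cat) T_functor"
proof -
  let ?F = "Func_cat (op_cat Ord_cat) Filt_cat ::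
    ((nat, nat \<Rightarrow> nat, 'a list filt, 'a list \<Rightarrow> 'a list) func, nat \<Rightarrow> 'a list \<Rightarrow> 'a list) cat"
  have Ob: "Ob (op_cat Ord_cat) = UNIV"
    by (simp add: op_cat_def Ord_cat_def)
  have cat: "is_category ?F"
    by (intro is_category_Func is_category_op is_category_Ord is_category_Filt)
  have on_ob: "on_ob T_functor = T_ob"
    by (simp add: T_functor_def)
  have hom: "on_hom T_functor X Y \<in> Hom Top_cat X Y \<rightarrow>\<^sub>E Hom ?F (T_ob X) (T_ob Y)"
    for X Y :: "'a topology"
  proof (rule PiE_I)
    fix f assume f: "f \<in> Hom Top_cat X Y"
    then have "continuous_map X Y f"
      by (simp add: Top_cat_def)
    then show "on_hom T_functor X Y f \<in> Hom ?F (T_ob X) (T_ob Y)"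
      using nat_trans_T_obI by (simp add: Func_cat_def on_hom_T_functor[OF f])
  qed (simp add: T_functor_def)
  have ident: "on_hom T_functor X X (Ident Top_cat X) = Ident ?F (T_ob X)"
    for X :: "'a topology"
  proof -
    have i: "Ident Top_cat X \<in> Hom Top_cat X X"
      using is_category_Top unfolding is_category_def by (auto simp: Top_cat_def)
    have "map (\<lambda>x\<in>topspace X. x) xs = xs" if "xs \<in> power_set X n" for xs n
      using that by (auto simp: power_set_def intro!: map_idI)
    then show ?thesis
      unfolding on_hom_T_functor[OF i]
      by (intro ext) (auto simp: Func_cat_def Filt_cat_def Top_cat_def Ob on_ob_T_ob)
  qed
  have comp: "on_hom T_functor X Z (Comp Top_cat X Y Z g f) =
      Comp ?F (T_ob X) (T_ob Y) (T_ob Z) (on_hom T_functor Y Z g) (on_hom T_functor X Y f)"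
    if f: "f \<in> Hom Top_cat X Y" and g: "g \<in> Hom Top_cat Y Z" for X Y Z :: "'a topology" and f g
  proof -
    have c: "Comp Top_cat X Y Z g f \<in> Hom Top_cat X Z"
      by (rule Comp_in_Hom[OF is_category_Top _ _ _ f g]) (simp_all add: Top_cat_def)
    have im: "f \<in> topspace X \<rightarrow> topspace Y"
      using f by (simp add: Top_cat_def continuous_map_def)
    have "map (compose (topspace X) g f) xs = map g (map f xs)" if "xs \<in> power_set X n" for xs n
      using that by (auto simp: power_set_def compose_def)
    then show ?thesis
      unfolding on_hom_T_functor[OF c] on_hom_T_functor[OF f] on_hom_T_functor[OF g]
      by (intro ext)
        (auto simp: Func_cat_def Comp_Filt_T_ob Top_cat_def Ob map_in_power_set[OF im] compose_def)
  qed
  show ?thesis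
    unfolding is_functor_def on_ob
    using is_category_Top cat hom ident comp is_functor_T_ob
    by (auto simp: Func_cat_def Top_cat_def)
qed

text \<open>The coordinate projections are the action of the one-point inclusions, so naturality
  computes every coordinate of every component from the component on \<open>1\<close>-tuples.\<close>

lemma nat_trans_T_obE:
  assumes \<eta>: "\<eta> \<in> nat_trans (op_cat Ord_cat) Filt_cat (T_ob X) (T_ob Y)"
  obtains f where "f \<in> Hom Top_cat X Y" "\<eta> = on_hom T_functor X Y f"
proof -
  have hom: "\<eta> n \<in> power_set X n \<rightarrow>\<^sub>E power_set Y n"
    and big: "\<And>P. topoic Y n P \<Longrightarrow> topoic X n {xs \<in> power_set X n. \<eta> n xs \<in> P}" for n
    using \<eta> by (auto simp: nat_trans_def op_cat_def Ord_cat_def Hom_Filt_T_ob)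
  define f where "f = (\<lambda>x\<in>topspace X. \<eta> 1 [x] ! 0)"
  have comp: "\<eta> n xs = map f xs" if xs: "xs \<in> power_set X n" for n xs
  proof (rule nth_equalityI)
    have \<eta>xs: "\<eta> n xs \<in> power_set Y n"
      using hom xs by blast
    then show len: "length (\<eta> n xs) = length (map f xs)"
      using xs by (simp add: power_set_def)
    fix k assume "k < length (\<eta> n xs)"
    then have k: "k < n"
      using \<eta>xs by (simp add: power_set_def)
    (* The inclusion of the one-element order at k + 1; it induces the k-th projection. *)
    let ?i = "\<lambda>_\<in>{1..1::nat}. Suc k"
    have i: "?i \<in> Hom (op_cat Ord_cat) n 1"
      using k by (auto simp: Hom_op_Ord mono_on_def)
    have "compose (power_set X n) (\<eta> 1) (on_hom (T_ob X) n 1 ?i) =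
        compose (power_set X n) (on_hom (T_ob Y) n 1 ?i) (\<eta> n)"
      using \<eta> i by (auto simp: nat_trans_def Comp_Filt_T_ob op_cat_def Ord_cat_def)
    from fun_cong[OF this[unfolded on_hom_T_ob[OF i]], of xs]
    have "\<eta> 1 [xs ! k] = [\<eta> n xs ! k]"
      using xs \<eta>xs by (simp add: compose_eq reindex_def)
    moreover have "xs ! k \<in> topspace X"
      using xs k by (auto simp: power_set_def)
    ultimately show "\<eta> n xs ! k = map f xs ! k"
      using xs k by (simp add: f_def power_set_def)
  qed
  have "f \<in> topspace X \<rightarrow> topspace Y"
  proof
    fix x assume "x \<in> topspace X"
    then have "[x] \<in> power_set X 1"
      by (simp add: power_set_def)
    then have "map f [x] \<in> power_set Y 1"
      using comp hom by (metis PiE_mem)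
    then show "f x \<in> topspace Y"
      by (simp add: power_set_def)
  qed
  moreover have "topoic X 2 {xs \<in> power_set X 2. map f xs \<in> P}" if "topoic Y 2 P" for P
    using big[OF that] comp by (simp cong: conj_cong)
  ultimately have "continuous_map X Y f"
    by (rule continuous_map_topoic)
  then have f: "f \<in> Hom Top_cat X Y"
    by (simp add: Top_cat_def f_def)
  have "\<eta> n = (\<lambda>xs\<in>power_set X n. map f xs)" for n
    using comp PiE_arb[OF hom] by (auto simp: restrict_def)
  then have "\<eta> = on_hom T_functor X Y f"
    by (auto simp: on_hom_T_functor[OF f])
  with f show thesis
    by (rule that)
qed

lemma inj_on_T_functor: "inj_on (on_hom T_functor X Y) (Hom Top_cat X Y)"
proof (rule inj_onI)
  fix f g
  assume f: "f \<in> Hom Top_cat X Y" and g: "g \<in> Hom Top_cat X Y"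
    and eq: "on_hom T_functor X Y f = on_hom T_functor X Y g"
  show "f = g"
  proof (rule extensionalityI)
    fix x assume "x \<in> topspace X"
    then have "[x] \<in> power_set X 1"
      by (simp add: power_set_def)
    then show "f x = g x"
      using fun_cong[OF fun_cong[OF eq, of 1], of "[x]"]
      by (simp add: on_hom_T_functor[OF f] on_hom_T_functor[OF g])
  qed (use f g in \<open>auto simp: Top_cat_def\<close>)
qed

lemma T_functor_image:
  "on_hom T_functor X Y ` Hom Top_cat X Y =
    nat_trans (op_cat Ord_cat) Filt_cat (T_ob X) (T_ob Y)"
proof
  show "on_hom T_functor X Y ` Hom Top_cat X Y \<subseteq>
      nat_trans (op_cat Ord_cat) Filt_cat (T_ob X) (T_ob Y)"
    using nat_trans_T_obI by (auto simp: on_hom_T_functor) (auto simp: Top_cat_def)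
  show "nat_trans (op_cat Ord_cat) Filt_cat (T_ob X) (T_ob Y) \<subseteq>
      on_hom T_functor X Y ` Hom Top_cat X Y"
    using nat_trans_T_obE by blast
qed

theorem mainTheorem3:
  "(\<forall>X :: 'a topology. is_functor (op_cat Ord_cat) Filt_cat (T_ob X)) \<and>
   is_functor (Top_cat :: ('a topology, 'a \<Rightarrow> 'a) cat)
     (Func_cat (op_cat Ord_cat) Filt_cat) T_functor \<and>
   full (Top_cat :: ('a topology, 'a \<Rightarrow> 'a) cat)
     (Func_cat (op_cat Ord_cat) Filt_cat) T_functor \<and>
   faithful (Top_cat :: ('a topology, 'a \<Rightarrow> 'a) cat)
     (Func_cat (op_cat Ord_cat) Filt_cat) T_functor \<and>
   (\<forall>X Y :: 'a topology.
      bij_betw (on_hom T_functor X Y) (Hom Top_cat X Y)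
        (nat_trans (op_cat Ord_cat) Filt_cat (T_ob X) (T_ob Y)))"
proof (intro conjI allI)
  show "full (Top_cat :: ('a topology, 'a \<Rightarrow> 'a) cat)
      (Func_cat (op_cat Ord_cat) Filt_cat) T_functor"
    by (simp add: full_def T_functor_image) (simp add: T_functor_def Func_cat_def)
qed (simp_all add: is_functor_T_ob is_functor_T_functor faithful_def bij_betw_def
    inj_on_T_functor T_functor_image)

end
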